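(* Let $G$ and $H$ be finite graphs (each with at least one vertex). If $a(G)\le \frac12$ or $a(H)\le \frac12$, then \[ a(G\times H)\le \max\{a(G),a(H)\}. \]
   Context: All graphs are finite, simple and undirected. For a set $U\subseteq V(G)$, $N_G(U)$ denotes the neighborhood of $U$ in $G$, i.e. the set of vertices adjacent to some vertex of $U$. For a graph $G$ define \[ a(G)=\max\left\{\frac{|U|}{|U|+|N_G(U)|}\ :\ U \text{ a nonempty independent set of } G\right\}. \] The categorical (direct, tensor) product $G\times H$ has vertex set $V(G)\times V(H)$, and $\{(x_1,y_1),(x_2,y_2)\}$ is an edge iff $\{x_1,x_2\}\in E(G)$ and $\{y_1,y_2\}\in E(H)$. *)

theory Defs
  imports Complex_Main "Graph_Theory.Pair_Digraph"
begin

text \<open>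
  A finite simple undirected graph is a \<^locale>\<open>pair_graph\<close>: the edge \<open>{u, v}\<close> is represented
  by the two arcs \<open>(u, v)\<close> and \<open>(v, u)\<close>.  The locale admits the graph without vertices.
\<close>

definition neighborhood :: "'a pair_pre_digraph \<Rightarrow> 'a set \<Rightarrow> 'a set" where
  "neighborhood G U = {v \<in> pverts G. \<exists>u\<in>U. (u, v) \<in> parcs G}"

definition independent_set :: "'a pair_pre_digraph \<Rightarrow> 'a set \<Rightarrow> bool" where
  "independent_set G U \<longleftrightarrow> U \<subseteq> pverts G \<and> (\<forall>u\<in>U. \<forall>v\<in>U. (u, v) \<notin> parcs G)"

definition indep_ratios :: "'a pair_pre_digraph \<Rightarrow> real set" where
  "indep_ratios G =
    {real (card U) / (real (card U) + real (card (neighborhood G U))) | U.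
      U \<noteq> {} \<and> independent_set G U}"

text \<open>
  The maximum is taken over a finite nonempty set whenever the graph is finite and has a vertex,
  see \<open>finite_indep_ratios\<close> and \<open>indep_ratios_nonempty\<close> below.
\<close>

definition a_ratio :: "'a pair_pre_digraph \<Rightarrow> real" where
  "a_ratio G = Max (indep_ratios G)"

definition categorical_product ::
  "'a pair_pre_digraph \<Rightarrow> 'b pair_pre_digraph \<Rightarrow> ('a \<times> 'b) pair_pre_digraph"
  (infixr \<open>\<times>\<^sub>g\<close> 80) where
  "G \<times>\<^sub>g H =
    \<lparr> pverts = pverts G \<times> pverts H,
      parcs = {((x1, y1), (x2, y2)) | x1 y1 x2 y2. (x1, x2) \<in> parcs G \<and> (y1, y2) \<in> parcs H} \<rparr>"

lemma finite_indep_ratios: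
  assumes "pair_graph G"
  shows "finite (indep_ratios G)"
proof -
  interpret pair_graph G by fact
  have "indep_ratios G \<subseteq>
    (\<lambda>U. real (card U) / (real (card U) + real (card (neighborhood G U)))) ` Pow (pverts G)"
    by (auto simp: indep_ratios_def independent_set_def)
  then show ?thesis
    using pair_finite_verts by (meson finite_Pow_iff finite_imageI finite_subset)
qed

lemma indep_ratios_nonempty:
  assumes "pair_graph G" and "pverts G \<noteq> {}"
  shows "indep_ratios G \<noteq> {}"
proof -
  interpret pair_graph G by fact
  obtain v where "v \<in> pverts G" using assms(2) by blast
  moreover have "(v, v) \<notin> parcs G" using pair_no_loops by fastforce
  ultimately have "independent_set G {v}" by (simp add: independent_set_def)
  then show ?thesis unfolding indep_ratios_def by blast
qed

lemma pair_graph_categorical_product: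
  assumes "pair_graph G" and "pair_graph H"
  shows "pair_graph (G \<times>\<^sub>g H)"
proof -
  interpret G: pair_graph G by fact
  interpret H: pair_graph H by fact
  have symG: "(v, u) \<in> parcs G" if "(u, v) \<in> parcs G" for u v
    using G.pair_sym_arcs that by (auto simp: symmetric_def dest: symD)
  have symH: "(v, u) \<in> parcs H" if "(u, v) \<in> parcs H" for u v
    using H.pair_sym_arcs that by (auto simp: symmetric_def dest: symD)
  have sub: "parcs (G \<times>\<^sub>g H) \<subseteq> (pverts G \<times> pverts H) \<times> (pverts G \<times> pverts H)"
    by (auto simp: categorical_product_def dest: G.wellformed' H.wellformed')
  show ?thesis
  proof unfold_locales
    show "fst e \<in> pverts (G \<times>\<^sub>g H)" "snd e \<in> pverts (G \<times>\<^sub>g H)" if "e \<in> parcs (G \<times>\<^sub>g H)" for e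
      using that sub by (auto simp: categorical_product_def dest: G.wellformed' H.wellformed')
    show "finite (pverts (G \<times>\<^sub>g H))"
      using G.pair_finite_verts H.pair_finite_verts by (simp add: categorical_product_def)
    show "finite (parcs (G \<times>\<^sub>g H))"
      by (rule finite_subset[OF sub]) (simp add: G.pair_finite_verts H.pair_finite_verts)
    show "fst e \<noteq> snd e" if "e \<in> parcs (G \<times>\<^sub>g H)" for e
      using that G.pair_no_loops by (fastforce simp: categorical_product_def)
    show "symmetric (with_proj (G \<times>\<^sub>g H))"
      by (auto simp: symmetric_def categorical_product_def intro!: symI symG symH)
  qed
qed

end

theory Submission
  imports Defs
begin

text \<open>
  With \<open>k = (1 - m) / m\<close>, the bound \<open>a(G) \<le> m\<close> says that \<open>k |S| \<le> |N(S)|\<close> for every independent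
  \<open>S\<close>; in particular \<open>a(H) \<le> 1/2\<close> says that independent sets of \<open>H\<close> do not shrink.
  Following Zhu, split an independent set \<open>U\<close> of \<open>G \<times> H\<close> into the set \<open>A\<close> of the \<open>(x, y) \<in> U\<close> for
  which no \<open>(x', y) \<in> U\<close> has \<open>x'\<close> adjacent to \<open>x\<close>, and \<open>B = U - A\<close>.  The layers \<open>A(y)\<close> are
  independent in \<open>G\<close>, hence \<open>M = {(x, y). x \<in> N(A(y))}\<close> has at least \<open>k |A|\<close> elements.  In the
  layer over \<open>x\<close>, the set \<open>B(x)\<close> is independent in \<open>H\<close> and no edge joins it to \<open>M(x)\<close>, so that
  \<open>|N(M(x) \<union> B(x))| \<ge> |M(x)| + k |B(x)|\<close>: the vertices of \<open>M(x)\<close> with no neighbour in \<open>M(x)\<close>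
  form an independent set together with \<open>B(x)\<close>, and the other vertices of \<open>M(x)\<close> lie in \<open>N(M(x))\<close>
  but not in the neighbourhood of that independent set.  Since \<open>{x} \<times> N(M(x) \<union> B(x))\<close> lies in \<open>N(U)\<close>,
  summing over \<open>x\<close> gives \<open>|N(U)| \<ge> |M| + k |B| \<ge> k |U|\<close>.
\<close>

section \<open>Neighborhoods, independent sets and bounds on the ratio\<close>

lemma neighborhood_iff:
  assumes "pair_graph G"
  shows "v \<in> neighborhood G U \<longleftrightarrow> (\<exists>u\<in>U. (u, v) \<in> parcs G)"
proof -
  interpret pair_graph G by fact
  show ?thesis by (auto simp: neighborhood_def dest: wellformed')
qed

lemma pair_graph_arc_sym:
  assumes "pair_graph G" and "(u, v) \<in> parcs G"
  shows "(v, u) \<in> parcs G"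
proof -
  interpret pair_graph G by fact
  show ?thesis
    using pair_sym_arcs assms(2) by (auto simp: symmetric_def dest: symD)
qed

lemma finite_neighborhood:
  assumes "pair_graph G"
  shows "finite (neighborhood G U)"
proof -
  interpret pair_graph G by fact
  show ?thesis by (rule finite_subset[OF _ pair_finite_verts]) (auto simp: neighborhood_def)
qed

lemma independent_set_finite:
  assumes "pair_graph G" and "independent_set G U"
  shows "finite U"
proof -
  interpret pair_graph G by fact
  show ?thesis
    using assms(2) finite_subset[OF _ pair_finite_verts] by (auto simp: independent_set_def)
qed

text \<open>Clearing the denominator turns a bound on the ratio into an expansion inequality. The
  empty set, excluded from the maximum, satisfies it trivially, so the inequality applies to empty
  layers too.\<close>

lemma a_ratio_le_iff:
  assumes "pair_graph G" and "pverts G \<noteq> {}" and "m > 0"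
  shows "a_ratio G \<le> m \<longleftrightarrow>
    (\<forall>U. independent_set G U \<longrightarrow> (1 - m) / m * real (card U) \<le> real (card (neighborhood G U)))"
proof -
  have ratio: "real (card U) / (real (card U) + real (card (neighborhood G U))) \<le> m \<longleftrightarrow>
      (1 - m) / m * real (card U) \<le> real (card (neighborhood G U))"
    if "independent_set G U" "U \<noteq> {}" for U
  proof -
    have "real (card U) > 0"
      using independent_set_finite[OF assms(1) that(1)] that(2) by (simp add: card_gt_0_iff)
    then have "real (card U) + real (card (neighborhood G U)) > 0" by linarith
    then show ?thesis using \<open>m > 0\<close> by (simp add: field_simps)
  qed
  have "a_ratio G \<le> m \<longleftrightarrow> (\<forall>r\<in>indep_ratios G. r \<le> m)"
    unfolding a_ratio_def
    using finite_indep_ratios[OF assms(1)] indep_ratios_nonempty[OF assms(1,2)] by simp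
  also have "\<dots> \<longleftrightarrow> (\<forall>U. U \<noteq> {} \<and> independent_set G U \<longrightarrow>
      (1 - m) / m * real (card U) \<le> real (card (neighborhood G U)))"
    using ratio by (auto simp: indep_ratios_def)
  also have "\<dots> \<longleftrightarrow> (\<forall>U. independent_set G U \<longrightarrow>
      (1 - m) / m * real (card U) \<le> real (card (neighborhood G U)))"
    by (metis card.empty mult_zero_right of_nat_0 of_nat_0_le_iff)
  finally show ?thesis .
qed

text \<open>Allows division by \<open>m\<close> when \<open>m\<close> is the larger of the two
  ratios.\<close>

lemma a_ratio_pos:
  assumes "pair_graph G" and "pverts G \<noteq> {}"
  shows "a_ratio G > 0"
proof -
  have "a_ratio G \<in> indep_ratios G"
    unfolding a_ratio_def
    using finite_indep_ratios[OF assms(1)] indep_ratios_nonempty[OF assms] by (rule Max_in)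
  then obtain U where U: "U \<noteq> {}" "independent_set G U"
    and eq: "a_ratio G = real (card U) / (real (card U) + real (card (neighborhood G U)))"
    by (auto simp: indep_ratios_def)
  have "real (card U) > 0"
    using independent_set_finite[OF assms(1) U(2)] U(1) by (simp add: card_gt_0_iff)
  then show ?thesis unfolding eq by (intro divide_pos_pos) linarith+
qed

section \<open>Counting and expansion in layers\<close>

lemma card_eq_sum_Image:
  assumes "finite X" and "finite S" and "S \<subseteq> X \<times> Y"
  shows "card S = (\<Sum>x\<in>X. card (S `` {x}))"
proof -
  have "S = Sigma X (\<lambda>x. S `` {x})" using assms(3) by auto
  then have "card S = card (Sigma X (\<lambda>x. S `` {x}))" by (rule arg_cong)
  also have "\<dots> = (\<Sum>x\<in>X. card (S `` {x}))"
    using assms(1,2) by (intro card_SigmaI) auto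
  finally show ?thesis .
qed

lemma card_eq_sum_converse_Image:
  assumes "finite Y" and "finite S" and "S \<subseteq> X \<times> Y"
  shows "card S = (\<Sum>y\<in>Y. card (S\<inverse> `` {y}))"
  using card_eq_sum_Image[of Y "S\<inverse>" X] assms by auto

lemma card_neighborhood_Un_ge:
  assumes H: "pair_graph H" and P: "P \<subseteq> pverts H" and B: "independent_set H B"
    and PB: "\<And>u v. u \<in> P \<Longrightarrow> v \<in> B \<Longrightarrow> (u, v) \<notin> parcs H"
    and one: "\<And>S. independent_set H S \<Longrightarrow> card S \<le> card (neighborhood H S)"
    and k: "\<And>S. independent_set H S \<Longrightarrow> k * real (card S) \<le> real (card (neighborhood H S))"
    and disj: "P \<inter> B = {}"
  shows "real (card P) + k * real (card B) \<le> real (card (neighborhood H (P \<union> B)))"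
proof -
  interpret pair_graph H by fact
  define I where "I = {u \<in> P. \<forall>v\<in>P. (u, v) \<notin> parcs H}"
  define R where "R = P - I"
  have finP: "finite P" using P pair_finite_verts by (rule finite_subset)
  have finI: "finite I" and finR: "finite R" using finP by (auto simp: I_def R_def)
  have finB: "finite B" using independent_set_finite[OF H B] .
  have BP: "(v, u) \<notin> parcs H" if "u \<in> P" "v \<in> B" for u v
    using PB that pair_graph_arc_sym[OF H] by blast
  have ind: "independent_set H (I \<union> B)"
    using B P PB BP unfolding independent_set_def I_def by blast
  have sub: "R \<union> neighborhood H (I \<union> B) \<subseteq> neighborhood H (P \<union> B)"
  proof
    fix v assume "v \<in> R \<union> neighborhood H (I \<union> B)"
    then consider "v \<in> R" | "v \<in> neighborhood H (I \<union> B)" by blast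
    then show "v \<in> neighborhood H (P \<union> B)"
    proof cases
      case 1
      then obtain w where "w \<in> P" "(v, w) \<in> parcs H" by (auto simp: R_def I_def)
      then show ?thesis using pair_graph_arc_sym[OF H] by (auto simp: neighborhood_iff[OF H])
    next
      case 2
      then show ?thesis by (auto simp: neighborhood_iff[OF H] I_def)
    qed
  qed
  \<comment> \<open>A vertex of \<open>R\<close> lies in \<open>P\<close>; vertices of
    \<open>I\<close> have no neighbor in \<open>P\<close> by definition, those of \<open>B\<close>
    none by \<open>PB\<close>.\<close>
  have "R \<inter> neighborhood H (I \<union> B) = {}"
    using BP by (auto simp: neighborhood_iff[OF H] I_def R_def)
  then have "card R + card (neighborhood H (I \<union> B)) = card (R \<union> neighborhood H (I \<union> B))"
    using finR finite_neighborhood[OF H] by (simp add: card_Un_disjoint)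
  also have "\<dots> \<le> card (neighborhood H (P \<union> B))"
    using sub by (rule card_mono[OF finite_neighborhood[OF H]])
  finally have 1: "real (card R) + real (card (neighborhood H (I \<union> B)))
      \<le> real (card (neighborhood H (P \<union> B)))"
    by linarith
  have cardP: "card P = card R + card I"
    using card_Un_disjoint[OF finR finI] by (auto simp: R_def I_def Un_absorb2)
  have "card (I \<union> B) = card I + card B"
    using disj by (intro card_Un_disjoint finI finB) (auto simp: I_def)
  then have 2: "card I + card B \<le> card (neighborhood H (I \<union> B))"
      "k * real (card I) + k * real (card B) \<le> real (card (neighborhood H (I \<union> B)))"
    using one[OF ind] k[OF ind] by (simp_all add: algebra_simps)
  \<comment> \<open>The factor is 1 on \<open>I\<close> but \<open>k\<close> on \<open>B\<close>. If
    \<open>k\<close> \<le> 1, lower the coefficient of \<open>B\<close> in the bound from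
    \<open>one\<close>; otherwise lower that of \<open>I\<close> in the bound from
    \<open>k\<close>.\<close>
  have "real (card I) + k * real (card B) \<le> real (card (neighborhood H (I \<union> B)))"
  proof (cases "k \<le> 1")
    case True
    then have "k * real (card B) \<le> real (card B)" by (simp add: mult_le_cancel_right2)
    then show ?thesis using 2(1) by linarith
  next
    case False
    then have "real (card I) \<le> k * real (card I)" by (simp add: mult_le_cancel_right1)
    then show ?thesis using 2(2) by linarith
  qed
  then show ?thesis using 1 cardP by linarith
qed

text \<open>The hypotheses are asymmetric because the mixed bound 1 and \<open>k\<close> is applied
  only to layers over vertices of \<open>G\<close>, which lie in \<open>H\<close>.\<close>

lemma card_neighborhood_product_ge:
  assumes G: "pair_graph G" and H: "pair_graph H"
    and kG: "\<And>S. independent_set G S \<Longrightarrow> k * real (card S) \<le> real (card (neighborhood G S))"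
    and kH: "\<And>S. independent_set H S \<Longrightarrow> k * real (card S) \<le> real (card (neighborhood H S))"
    and oneH: "\<And>S. independent_set H S \<Longrightarrow> card S \<le> card (neighborhood H S)"
    and U: "independent_set (G \<times>\<^sub>g H) U"
  shows "k * real (card U) \<le> real (card (neighborhood (G \<times>\<^sub>g H) U))"
proof -
  interpret G: pair_graph G by fact
  interpret H: pair_graph H by fact
  note GH = pair_graph_categorical_product[OF G H]
  note symG = pair_graph_arc_sym[OF G] and symH = pair_graph_arc_sym[OF H]
  define N where "N = neighborhood (G \<times>\<^sub>g H) U"
  define A where "A = {(x, y) \<in> U. \<forall>x'. (x', y) \<in> U \<longrightarrow> (x, x') \<notin> parcs G}"
  define B where "B = U - A"
  define M where "M = {(x, y). x \<in> neighborhood G (A\<inverse> `` {y})}"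
  have UV: "U \<subseteq> pverts G \<times> pverts H"
    using U by (simp add: independent_set_def categorical_product_def)
  have nonadj: "(y, y') \<notin> parcs H" if "(x, y) \<in> U" "(x', y') \<in> U" "(x, x') \<in> parcs G" for x y x' y'
    using U that unfolding independent_set_def categorical_product_def by fastforce
  have N_iff: "(x, y) \<in> N \<longleftrightarrow> (\<exists>x' y'. (x', y') \<in> U \<and> (x', x) \<in> parcs G \<and> (y', y) \<in> parcs H)" for x y
    unfolding N_def neighborhood_iff[OF GH] by (force simp: categorical_product_def)
  have NV: "N \<subseteq> pverts G \<times> pverts H"
    by (auto simp: N_def neighborhood_def categorical_product_def)
  have AU: "A \<subseteq> U" and BU: "B \<subseteq> U" by (auto simp: A_def B_def)
  have M_iff: "(x, y) \<in> M \<longleftrightarrow> (\<exists>x'. (x', y) \<in> A \<and> (x', x) \<in> parcs G)" for x y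
    by (auto simp: M_def neighborhood_iff[OF G])
  have B_nbr: "\<exists>x'. (x', y) \<in> U \<and> (x, x') \<in> parcs G" if "(x, y) \<in> B" for x y
    using that by (auto simp: A_def B_def)
  have MV: "M \<subseteq> pverts G \<times> pverts H"
    using subset_trans[OF AU UV] by (auto simp: M_iff dest: G.wellformed')
  have finV: "finite (pverts G \<times> pverts H)"
    by (simp add: G.pair_finite_verts H.pair_finite_verts)
  have fin: "finite U" "finite A" "finite B" "finite M" "finite N"
    using finite_subset[OF UV finV] finite_subset[OF MV finV] finite_subset[OF NV finV]
      finite_subset[OF AU] finite_subset[OF BU] by auto
  have "k * real (card A) = (\<Sum>y\<in>pverts H. k * real (card (A\<inverse> `` {y})))"
    using card_eq_sum_converse_Image[OF H.pair_finite_verts fin(2), of "pverts G"] AU UV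
    by (simp add: sum_distrib_left)
  also have "\<dots> \<le> (\<Sum>y\<in>pverts H. real (card (M\<inverse> `` {y})))"
  proof (rule sum_mono)
    fix y
    have "independent_set G (A\<inverse> `` {y})"
      using UV by (auto simp: independent_set_def A_def)
    moreover have "M\<inverse> `` {y} = neighborhood G (A\<inverse> `` {y})" by (auto simp: M_def)
    ultimately show "k * real (card (A\<inverse> `` {y})) \<le> real (card (M\<inverse> `` {y}))"
      using kG by simp
  qed
  also have "\<dots> = real (card M)"
    using card_eq_sum_converse_Image[OF H.pair_finite_verts fin(4) MV] by simp
  finally have A_le: "k * real (card A) \<le> real (card M)" .
  have "real (card M) + k * real (card B)
      = (\<Sum>x\<in>pverts G. real (card (M `` {x})) + k * real (card (B `` {x})))"
    using card_eq_sum_Image[OF G.pair_finite_verts fin(4) MV]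
      card_eq_sum_Image[OF G.pair_finite_verts fin(3), of "pverts H"] BU UV
    by (simp add: sum_distrib_left sum.distrib)
  also have "\<dots> \<le> (\<Sum>x\<in>pverts G. real (card (N `` {x})))"
  proof (rule sum_mono)
    fix x
    have "real (card (M `` {x})) + k * real (card (B `` {x}))
        \<le> real (card (neighborhood H (M `` {x} \<union> B `` {x})))"
    proof (rule card_neighborhood_Un_ge[OF H _ _ _ oneH kH])
      show "M `` {x} \<subseteq> pverts H" using MV by auto
      show "independent_set H (B `` {x})"
        unfolding independent_set_def
      proof (intro conjI ballI)
        show "B `` {x} \<subseteq> pverts H" using BU UV by auto
        fix y y' assume "y \<in> B `` {x}" "y' \<in> B `` {x}"
        \<comment> \<open>\<open>B_nbr\<close> gives \<open>(x', y)\<close> in \<open>U\<close> with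
          \<open>x'\<close> adjacent to \<open>x\<close>. If \<open>y\<close> and \<open>y'\<close>
          were adjacent, \<open>(x', y)\<close> and \<open>(x, y')\<close> would be adjacent members
          of \<open>U\<close>.\<close>
        then show "(y, y') \<notin> parcs H"
          using B_nbr[of x y] BU nonadj[of _ y x y'] symG[of x] by auto
      qed
      show "(y, y') \<notin> parcs H" if "y \<in> M `` {x}" "y' \<in> B `` {x}" for y y'
        using that subsetD[OF AU] subsetD[OF BU] nonadj by (auto simp: M_iff) blast
      \<comment> \<open>If \<open>(x, y)\<close> is in \<open>M\<close>, some \<open>(x', y)\<close>
        in \<open>A\<close> has \<open>x'\<close> adjacent to \<open>x\<close>; then
        \<open>(x, y)\<close> in \<open>U\<close> would contradict the choice of
        \<open>A\<close>.\<close>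
      show "M `` {x} \<inter> B `` {x} = {}"
        using subsetD[OF BU] by (auto simp: M_iff A_def)
    qed
    also have "neighborhood H (M `` {x} \<union> B `` {x}) \<subseteq> N `` {x}"
    proof
      fix y assume "y \<in> neighborhood H (M `` {x} \<union> B `` {x})"
      then obtain y' where y': "(y', y) \<in> parcs H" "(x, y') \<in> M \<or> (x, y') \<in> B"
        by (auto simp: neighborhood_iff[OF H])
      \<comment> \<open>Membership in \<open>M\<close> and in \<open>B\<close> yields the same
        thing: a point of \<open>U\<close> in the row of \<open>y'\<close> whose first coordinate is
        adjacent to \<open>x\<close>. It is adjacent to \<open>(x, y)\<close> in the
        product.\<close>
      then obtain x' where "(x', y') \<in> U" "(x', x) \<in> parcs G"
        using AU B_nbr[of x y'] symG[of x] by (auto simp: M_iff)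
      then show "y \<in> N `` {x}" using y'(1) by (auto simp: N_iff)
    qed
    then have "real (card (neighborhood H (M `` {x} \<union> B `` {x}))) \<le> real (card (N `` {x}))"
      using fin(5) by (simp add: card_mono)
    finally show "real (card (M `` {x})) + k * real (card (B `` {x})) \<le> real (card (N `` {x}))" .
  qed
  also have "\<dots> = real (card N)"
    using card_eq_sum_Image[OF G.pair_finite_verts fin(5) NV] by simp
  finally have "real (card M) + k * real (card B) \<le> real (card N)" .
  moreover have "card U = card A + card B"
    using card_Un_disjoint[OF fin(2,3)] AU by (auto simp: B_def Un_absorb1)
  ultimately show ?thesis
    using A_le by (simp add: N_def algebra_simps)
qed

section \<open>Exchanging the factors, and the conclusion\<close>

lemma indep_ratios_product_swap_subset:
  "indep_ratios (G \<times>\<^sub>g H) \<subseteq> indep_ratios (H \<times>\<^sub>g G)"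
proof
  fix r assume "r \<in> indep_ratios (G \<times>\<^sub>g H)"
  then obtain U where U: "U \<noteq> {}" "independent_set (G \<times>\<^sub>g H) U"
    and r: "r = real (card U) / (real (card U) + real (card (neighborhood (G \<times>\<^sub>g H) U)))"
    by (auto simp: indep_ratios_def)
  \<comment> \<open>Swapping coordinates, here taking the converse of \<open>U\<close>, is an
    isomorphism of the two products.\<close>
  have "independent_set (H \<times>\<^sub>g G) (U\<inverse>)"
    using U(2) unfolding independent_set_def categorical_product_def by fastforce
  moreover have "neighborhood (H \<times>\<^sub>g G) (U\<inverse>) = (neighborhood (G \<times>\<^sub>g H) U)\<inverse>"
    by (force simp: neighborhood_def categorical_product_def)
  ultimately show "r \<in> indep_ratios (H \<times>\<^sub>g G)"
    unfolding indep_ratios_def using U(1) r by (intro CollectI exI[of _ "U\<inverse>"]) auto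
qed

lemma a_ratio_product_commute: "a_ratio (G \<times>\<^sub>g H) = a_ratio (H \<times>\<^sub>g G)"
  unfolding a_ratio_def
  by (rule arg_cong[where f = Max]) (intro subset_antisym indep_ratios_product_swap_subset)

lemma a_ratio_product_le:
  assumes G: "pair_graph G" "pverts G \<noteq> {}" and H: "pair_graph H" "pverts H \<noteq> {}"
    and half: "a_ratio H \<le> 1 / 2"
  shows "a_ratio (G \<times>\<^sub>g H) \<le> max (a_ratio G) (a_ratio H)"
proof -
  define m where "m = max (a_ratio G) (a_ratio H)"
  have m: "m > 0" "a_ratio G \<le> m" "a_ratio H \<le> m"
    using a_ratio_pos[OF G] by (auto simp: m_def)
  have "pverts (G \<times>\<^sub>g H) \<noteq> {}"
    using G(2) H(2) by (simp add: categorical_product_def)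
  note iff = a_ratio_le_iff[OF pair_graph_categorical_product[OF G(1) H(1)] this m(1)]
  \<comment> \<open>For \<open>m\<close> = 1/2 the factor \<open>(1 - m) / m\<close> equals
    1.\<close>
  have "card S \<le> card (neighborhood H S)" if "independent_set H S" for S
    using half a_ratio_le_iff[OF H, of "1 / 2"] that by auto
  then have "a_ratio (G \<times>\<^sub>g H) \<le> m"
    unfolding iff
    using card_neighborhood_product_ge[OF G(1) H(1), of "(1 - m) / m"]
      a_ratio_le_iff[OF G m(1)] a_ratio_le_iff[OF H m(1)] m by blast
  then show ?thesis by (simp add: m_def)
qed

theorem theorem3p2:
  fixes G :: "'a pair_pre_digraph" and H :: "'b pair_pre_digraph"
  assumes "pair_graph G" and "pair_graph H"
    and "pverts G \<noteq> {}" and "pverts H \<noteq> {}"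
    and "a_ratio G \<le> 1 / 2 \<or> a_ratio H \<le> 1 / 2"
  shows "a_ratio (G \<times>\<^sub>g H) \<le> max (a_ratio G) (a_ratio H)"
  using assms(5)
proof
  assume "a_ratio G \<le> 1 / 2"
  then show ?thesis
    using a_ratio_product_le[OF assms(2,4,1,3)] by (simp add: a_ratio_product_commute[of G] max.commute)
next
  assume "a_ratio H \<le> 1 / 2"
  then show ?thesis by (rule a_ratio_product_le[OF assms(1,3,2,4)])
qed

end
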